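(* Let $X$ be a positive random variable such that $\|X\|_\infty<\infty$ and let $\beta(\cdot)$ be its beta function. If the limit $\lim_{x\to\|X\|_\infty}\beta(x)=\beta_0$ exists and $\beta_0<1$, then the variable $X$ is regularly varying with exponent $p=\beta_0/(1-\beta_0)$.
   Context: $\|X\|_\infty$ is the essential supremum of $X$. Beta function of $X$: let $w(x)=P(X>x)$ and $h(x)=\int_x^\infty w(x')\,dx'$, $x\ge0$. Assuming $h$ is $C^2$ on $[0,\|X\|_\infty)$, the beta function is $\beta(x)=h''(x)h(x)/h'(x)^2$, $0\le x<\|X\|_\infty$. A positive random variable $X$ with $\|X\|_\infty<\infty$ is called regularly varying with exponent $p\ge0$ if $w(x)=P(X>x)$ satisfies $$\lim_{z\to0}\frac{w(\|X\|_\infty-\lambda z)}{\lambda^p\,w(\|X\|_\infty-z)}=1\quad\text{for all }\lambda>0$$ (where $z\to0$ through positive values). *)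

theory Defs
  imports "HOL-Probability.Probability"
begin

definition positive_rv :: "'a measure \<Rightarrow> ('a \<Rightarrow> real) \<Rightarrow> bool" where
  "positive_rv M X \<longleftrightarrow> prob_space M \<and> X \<in> borel_measurable M \<and> (AE \<omega> in M. 0 < X \<omega>)"

definition esup :: "'a measure \<Rightarrow> ('a \<Rightarrow> real) \<Rightarrow> ereal" where
  "esup M X = esssup M (\<lambda>\<omega>. ereal (X \<omega>))"

text \<open>The essential supremum as a real number; only meaningful when it is finite.\<close>

definition esup_real :: "'a measure \<Rightarrow> ('a \<Rightarrow> real) \<Rightarrow> real" where
  "esup_real M X = real_of_ereal (esup M X)"

definition tail :: "'a measure \<Rightarrow> ('a \<Rightarrow> real) \<Rightarrow> real \<Rightarrow> real" where
  "tail M X x = measure M {\<omega> \<in> space M. X \<omega> > x}"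

definition tail_integral :: "'a measure \<Rightarrow> ('a \<Rightarrow> real) \<Rightarrow> real \<Rightarrow> real" where
  "tail_integral M X x = (LINT t:{x..}|lborel. tail M X t)"

text \<open>Derivatives are taken within the set, hence one-sided at an endpoint belonging to it.
  In particular, on \<open>{0..<b}\<close> nothing is required of the function to the left of 0
  (where the tail of a positive variable is constantly 1).\<close>

definition C2_on :: "(real \<Rightarrow> real) \<Rightarrow> real set \<Rightarrow> bool" where
  "C2_on f S \<longleftrightarrow> (\<exists>f' f''.
     (\<forall>x\<in>S. (f has_real_derivative f' x) (at x within S)) \<and>
     (\<forall>x\<in>S. (f' has_real_derivative f'' x) (at x within S)) \<and>
     continuous_on S f'')"

definition deriv_within :: "real set \<Rightarrow> (real \<Rightarrow> real) \<Rightarrow> real \<Rightarrow> real" where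
  "deriv_within S f x = vector_derivative f (at x within S)"

definition beta_function :: "'a measure \<Rightarrow> ('a \<Rightarrow> real) \<Rightarrow> real \<Rightarrow> real" where
  "beta_function M X x =
     (let S = {0..<esup_real M X}; h = tail_integral M X;
          h' = deriv_within S h; h'' = deriv_within S h'
      in h'' x * h x / (h' x)\<^sup>2)"

definition regularly_varying :: "'a measure \<Rightarrow> ('a \<Rightarrow> real) \<Rightarrow> real \<Rightarrow> bool" where
  "regularly_varying M X p \<longleftrightarrow>
     positive_rv M X \<and> esup M X < \<infinity> \<and> 0 \<le> p \<and>
     (\<forall>l>0. ((\<lambda>z. tail M X (esup_real M X - l * z) /
                    (l powr p * tail M X (esup_real M X - z)))
             \<longlongrightarrow> 1) (at_right 0))"

end

theory Submission
  imports Defs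
begin

text \<open>Write \<open>b\<close> for the essential supremum, \<open>w\<close> for the tail and \<open>h\<close> for its integral.
  Since \<open>w\<close> is right-continuous, the right derivative of \<open>h\<close> is \<open>- w\<close>; hence the hypothesis that
  \<open>h\<close> is \<open>C\<^sup>2\<close> makes \<open>w\<close> continuously differentiable on \<open>[0, b)\<close>, with \<open>h' = - w\<close> and \<open>h'' = - w'\<close>.
  Measure positions by the distance \<open>z = b - x\<close> to the end point, and put \<open>W z = w (b - z)\<close> and
  \<open>H z = h (b - z)\<close>, so that \<open>H' = W\<close> and \<open>\<beta> = W' H / W\<^sup>2\<close>.

  The quotient \<open>H / W\<close> has derivative \<open>1 - \<beta>\<close>, which tends to \<open>1 - \<beta>0\<close>, and it vanishes at \<open>0\<close>
  because \<open>0 \<le> H z \<le> z W z\<close>. By l'Hopital's rule \<open>H z / (z W z)\<close> tends to \<open>1 - \<beta>0 > 0\<close>, and therefore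
  \<open>z W' z / W z = \<beta> / (H z / (z W z))\<close> tends to \<open>p = \<beta>0 / (1 - \<beta>0)\<close>
  (\<open>log_derivative_limit\<close>).

  In the variable \<open>s = ln z\<close> this says that \<open>ln W\<close> has a derivative tending to \<open>p\<close> as \<open>s\<close> tends to
  minus infinity, so its increment over a step \<open>ln l\<close> tends to \<open>p ln l\<close>, which is regular
  variation (\<open>ratio_tendsto_powr\<close>). Finally \<open>p \<ge> 0\<close>, because \<open>W\<close> is increasing.\<close>

section \<open>Regular variation at zero from the logarithmic derivative\<close>

lemma ratio_tendsto_powr:
  fixes F F' :: "real \<Rightarrow> real"
  assumes pos: "\<forall>\<^sub>F z in at_right 0. F z > 0"
    and deriv: "\<forall>\<^sub>F z in at_right 0. (F has_real_derivative F' z) (at z)"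
    and lim: "((\<lambda>z. z * F' z / F z) \<longlongrightarrow> p) (at_right 0)"
    and l: "l > 0"
  shows "((\<lambda>z. F (l * z) / F z) \<longlongrightarrow> l powr p) (at_right 0)"
proof -
  have ev_lz: "\<forall>\<^sub>F z in at_right 0. P (l * z)" if P: "\<forall>\<^sub>F z in at_right (0::real). P z" for P
  proof -
    obtain d where "d > 0" and d: "\<And>z. 0 < z \<Longrightarrow> z < d \<Longrightarrow> P z"
      using P by (auto simp: eventually_at_right_field)
    then show ?thesis
      using l by (auto simp: eventually_at_right_field field_simps intro!: exI[of _ "d / l"])
  qed
  have "((\<lambda>z. ln (F (l * z)) - ln (F z)) \<longlongrightarrow> p * ln l) (at_right 0)"
  proof (rule tendstoI)
    fix e :: real assume "e > 0"
    define B where "B = e / (1 + \<bar>ln l\<bar>)"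
    have "B > 0" "B * \<bar>ln l\<bar> < e"
      using \<open>e > 0\<close> by (auto simp: B_def field_simps add_pos_nonneg)
    have "\<forall>\<^sub>F z in at_right 0. F z > 0 \<and> (F has_real_derivative F' z) (at z)
            \<and> dist (z * F' z / F z) p < B"
      using pos deriv tendstoD[OF lim \<open>B > 0\<close>] by eventually_elim auto
    then obtain d where "d > 0" and d: "\<And>z. 0 < z \<Longrightarrow> z < d \<Longrightarrow>
        F z > 0 \<and> (F has_real_derivative F' z) (at z) \<and> dist (z * F' z / F z) p < B"
      by (auto simp: eventually_at_right_field)
    \<comment> \<open>In the variable \<open>s = ln z\<close> the function \<open>G\<close> has derivative \<open>z F' z / F z - p\<close>, which
      is less than \<open>B\<close> in absolute value for \<open>s < ln d\<close>.\<close>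
    define G where "G s = ln (F (exp s)) - p * s" for s
    have close: "norm (G s - G t) \<le> B * norm (s - t)" if "s < ln d" "t < ln d" for s t
    proof (rule field_differentiable_bound[where S = "{..<ln d}"
          and f' = "\<lambda>s. exp s * F' (exp s) / F (exp s) - p"])
      fix u assume "u \<in> {..<ln d}"
      then have "exp u < d"
        using \<open>d > 0\<close> by (metis exp_less_cancel_iff exp_ln lessThan_iff)
      note du = d[OF exp_gt_zero this]
      have "((\<lambda>s. F (exp s)) has_real_derivative F' (exp u) * exp u) (at u)"
        using DERIV_chain2[OF _ DERIV_exp] du by blast
      then have "(G has_real_derivative exp u * F' (exp u) / F (exp u) - p) (at u)"
        unfolding G_def using du by (auto intro!: derivative_eq_intros)
      then show "(G has_real_derivative exp u * F' (exp u) / F (exp u) - p)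
          (at u within {..<ln d})"
        by (rule has_field_derivative_at_within)
      show "norm (exp u * F' (exp u) / F (exp u) - p) \<le> B"
        using du by (simp add: dist_real_def)
    qed (use that in auto)
    have "\<forall>\<^sub>F z in at_right 0. 0 < z \<and> z < d"
      using \<open>d > 0\<close> by (auto simp: eventually_at_right_field)
    moreover note ev_lz[OF this]
    ultimately show "\<forall>\<^sub>F z in at_right 0.
        dist (ln (F (l * z)) - ln (F z)) (p * ln l) < e"
    proof eventually_elim
      case (elim z)
      then have "norm (G (ln (l * z)) - G (ln z)) \<le> B * norm (ln (l * z) - ln z)"
        using \<open>d > 0\<close> by (intro close) (auto simp del: ln_mult)
      also have "ln (l * z) = ln l + ln z"
        using elim l by (simp add: ln_mult)
      finally show ?case
        using elim l \<open>B * \<bar>ln l\<bar> < e\<close>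
        by (auto simp: G_def dist_real_def algebra_simps exp_add)
    qed
  qed
  then have "((\<lambda>z. exp (ln (F (l * z)) - ln (F z))) \<longlongrightarrow> exp (p * ln l)) (at_right 0)"
    by (rule tendsto_exp)
  moreover have "\<forall>\<^sub>F z in at_right 0. exp (ln (F (l * z)) - ln (F z)) = F (l * z) / F z"
    using pos ev_lz[OF pos] by eventually_elim (simp add: exp_diff)
  ultimately show ?thesis
    using l by (simp add: powr_def mult.commute tendsto_cong)
qed

text \<open>The bounds \<open>0 \<le> H z \<le> z W z\<close> hold when \<open>H z\<close> is the integral over \<open>[0, z]\<close> of a
  nonnegative increasing function \<open>W\<close>.\<close>

lemma log_derivative_limit:
  fixes H W W' :: "real \<Rightarrow> real"
  assumes pos: "\<forall>\<^sub>F z in at_right 0. W z > 0"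
    and H_bounds: "\<forall>\<^sub>F z in at_right 0. 0 \<le> H z \<and> H z \<le> z * W z"
    and H_deriv: "\<forall>\<^sub>F z in at_right 0. (H has_real_derivative W z) (at z)"
    and W_deriv: "\<forall>\<^sub>F z in at_right 0. (W has_real_derivative W' z) (at z)"
    and lim: "((\<lambda>z. W' z * H z / (W z)\<^sup>2) \<longlongrightarrow> c) (at_right 0)"
    and "c < 1"
  shows "((\<lambda>z. z * W' z / W z) \<longlongrightarrow> c / (1 - c)) (at_right 0)"
proof -
  have ev0: "\<forall>\<^sub>F z in at_right 0. z > (0::real)"
    by (rule eventually_at_right_less)
  have quot_0: "((\<lambda>z. H z / W z) \<longlongrightarrow> 0) (at_right 0)"
  proof (rule tendsto_sandwich[of "\<lambda>_. 0" _ _ "\<lambda>z. z"])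
    show "\<forall>\<^sub>F z in at_right 0. 0 \<le> H z / W z"
      using pos H_bounds by eventually_elim auto
    show "\<forall>\<^sub>F z in at_right 0. H z / W z \<le> z"
      using pos H_bounds by eventually_elim (auto simp: field_simps)
  qed (auto intro: tendsto_eq_intros)
  have quot: "((\<lambda>z. (H z / W z) / z) \<longlongrightarrow> 1 - c) (at_right 0)"
  proof (rule lhopital_right_0[where g' = "\<lambda>_. 1"
        and f' = "\<lambda>z. 1 - W' z * H z / (W z)\<^sup>2"])
    show "\<forall>\<^sub>F z in at_right 0.
        ((\<lambda>z. H z / W z) has_real_derivative 1 - W' z * H z / (W z)\<^sup>2) (at z)"
      using pos H_deriv W_deriv
      by eventually_elim
        (auto intro!: derivative_eq_intros simp: field_simps power2_eq_square)
    show "((\<lambda>z. (1 - W' z * H z / (W z)\<^sup>2) / 1) \<longlongrightarrow> 1 - c) (at_right 0)"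
      using lim by (auto intro: tendsto_intros)
    show "\<forall>\<^sub>F z in at_right 0. z \<noteq> (0::real)"
      using ev0 by eventually_elim auto
  qed (use quot_0 in auto)
  then have "((\<lambda>z. (W' z * H z / (W z)\<^sup>2) / ((H z / W z) / z)) \<longlongrightarrow> c / (1 - c)) (at_right 0)"
    using lim \<open>c < 1\<close> by (intro tendsto_divide) auto
  moreover have "\<forall>\<^sub>F z in at_right 0. (H z / W z) / z > 0"
    using quot \<open>c < 1\<close> by (intro order_tendstoD(1)[OF quot]) auto
  then have "\<forall>\<^sub>F z in at_right 0.
      (W' z * H z / (W z)\<^sup>2) / ((H z / W z) / z) = z * W' z / W z"
    using pos ev0 by eventually_elim (auto simp: field_simps power2_eq_square)
  ultimately show ?thesis
    by (simp add: tendsto_cong)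
qed

section \<open>The tail and its integral\<close>

lemma tail_antimono:
  assumes "positive_rv M X" "x \<le> y"
  shows "tail M X y \<le> tail M X x"
proof -
  interpret prob_space M using assms by (simp add: positive_rv_def)
  have [measurable]: "X \<in> borel_measurable M" using assms by (simp add: positive_rv_def)
  show ?thesis
    unfolding tail_def using \<open>x \<le> y\<close> by (intro finite_measure_mono) auto
qed

lemma tail_eq_cdf:
  assumes "positive_rv M X"
  shows "tail M X x = 1 - cdf (distr M borel X) x"
proof -
  interpret prob_space M using assms by (simp add: positive_rv_def)
  have [measurable]: "X \<in> borel_measurable M" using assms by (simp add: positive_rv_def)
  have "cdf (distr M borel X) x = prob {\<omega> \<in> space M. X \<omega> \<le> x}"
    by (auto simp: cdf_def measure_distr intro!: arg_cong[where f = prob])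
  also have "1 - \<dots> = prob (space M - {\<omega> \<in> space M. X \<omega> \<le> x})"
    by (rule prob_compl[symmetric]) simp
  also have "space M - {\<omega> \<in> space M. X \<omega> \<le> x} = {\<omega> \<in> space M. X \<omega> > x}"
    by auto
  finally show ?thesis by (simp add: tail_def)
qed

lemma tail_right_continuous:
  assumes "positive_rv M X"
  shows "(tail M X \<longlongrightarrow> tail M X x) (at_right x)"
proof -
  interpret prob_space M using assms by (simp add: positive_rv_def)
  have [measurable]: "X \<in> borel_measurable M" using assms by (simp add: positive_rv_def)
  interpret D: real_distribution "distr M borel X" by simp
  have "(cdf (distr M borel X) \<longlongrightarrow> cdf (distr M borel X) x) (at_right x)"
    using D.cdf_is_right_cont by (simp add: continuous_within)
  then have "((\<lambda>y. 1 - cdf (distr M borel X) y) \<longlongrightarrow> 1 - cdf (distr M borel X) x) (at_right x)"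
    by (intro tendsto_intros)
  moreover have "tail M X = (\<lambda>y. 1 - cdf (distr M borel X) y)"
    using tail_eq_cdf[OF assms] by auto
  ultimately show ?thesis by simp
qed

lemma esup_eq_ereal:
  assumes "positive_rv M X" "esup M X < \<infinity>"
  shows "esup M X = ereal (esup_real M X)" and "0 < esup_real M X"
proof -
  interpret prob_space M using assms by (simp add: positive_rv_def)
  have "AE \<omega> in M. ereal (X \<omega>) \<le> esup M X"
    unfolding esup_def by (rule esssup_AE)
  moreover have "AE \<omega> in M. 0 < X \<omega>"
    using assms by (simp add: positive_rv_def)
  ultimately have "AE \<omega> in M. 0 < esup M X"
    by eventually_elim (metis ereal_less(2) order_less_le_trans)
  then have "0 < esup M X" by simp
  with assms(2) show "esup M X = ereal (esup_real M X)" "0 < esup_real M X"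
    by (cases "esup M X"; auto simp: esup_real_def)+
qed

lemma tail_pos:
  assumes "positive_rv M X" "esup M X < \<infinity>" "x < esup_real M X"
  shows "0 < tail M X x"
proof -
  interpret prob_space M using assms by (simp add: positive_rv_def)
  have [measurable]: "X \<in> borel_measurable M" using assms by (simp add: positive_rv_def)
  have "ereal x < esssup M (\<lambda>\<omega>. ereal (X \<omega>))"
    using esup_eq_ereal(1)[OF assms(1,2)] assms(3) by (simp add: esup_def)
  from esssup_pos_measure[OF _ this] show ?thesis
    by (simp add: tail_def emeasure_eq_measure)
qed

lemma tail_eq_0:
  assumes "positive_rv M X" "esup M X < \<infinity>" "esup_real M X \<le> x"
  shows "tail M X x = 0"
proof -
  interpret prob_space M using assms by (simp add: positive_rv_def)
  have [measurable]: "X \<in> borel_measurable M" using assms by (simp add: positive_rv_def)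
  have "AE \<omega> in M. ereal (X \<omega>) \<le> esup M X"
    unfolding esup_def by (rule esssup_AE)
  then have "AE \<omega> in M. X \<omega> \<le> esup_real M X"
    using esup_eq_ereal(1)[OF assms(1,2)] by simp
  then have "AE \<omega> in M. \<not> X \<omega> > x"
    using assms(3) by auto
  then show ?thesis
    unfolding tail_def by (subst prob_eq_0[symmetric, THEN iffD1]) (auto simp: prob_eq_0)
qed

lemma tail_set_integrable:
  assumes "positive_rv M X" "esup M X < \<infinity>" "A \<in> sets borel" "A \<subseteq> {x..}"
  shows "set_integrable lborel A (tail M X)"
proof -
  interpret prob_space M using assms by (simp add: positive_rv_def)
  have "mono (\<lambda>x. - tail M X x)"
    using tail_antimono[OF assms(1)] by (auto simp: mono_def)
  then have "(\<lambda>x. - (- tail M X x)) \<in> borel_measurable borel"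
    by (intro borel_measurable_uminus borel_measurable_mono)
  then have [measurable]: "tail M X \<in> borel_measurable borel"
    by simp
  have "set_integrable lborel {x..} (tail M X)"
    unfolding set_integrable_def
  proof (rule Bochner_Integration.integrable_bound)
    show "integrable lborel (indicator {x..esup_real M X} :: real \<Rightarrow> real)"
      by (simp add: integrable_indicator_iff emeasure_lborel_Icc_eq)
    have "norm (indicator {x..} t *\<^sub>R tail M X t) \<le> norm (indicator {x..esup_real M X} t :: real)" for t
      using tail_eq_0[OF assms(1,2), of t] by (auto simp: indicator_def tail_def)
    then show "AE t in lborel. norm (indicator {x..} t *\<^sub>R tail M X t)
        \<le> norm (indicator {x..esup_real M X} t :: real)"
      by simp
  qed simp
  then show ?thesis
    by (rule set_integrable_subset) (use assms(3,4) in auto)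
qed

lemma tail_integral_diff_bounds:
  assumes "positive_rv M X" "esup M X < \<infinity>" "x \<le> y"
  shows "(y - x) * tail M X y \<le> tail_integral M X x - tail_integral M X y"
    and "tail_integral M X x - tail_integral M X y \<le> (y - x) * tail M X x"
proof -
  note int = tail_set_integrable[OF assms(1,2), of _ x]
  have "tail_integral M X x = (LINT t:{x..<y} \<union> {y..}|lborel. tail M X t)"
    unfolding tail_integral_def using \<open>x \<le> y\<close> by (simp add: ivl_disj_un)
  also have "\<dots> = (LINT t:{x..<y}|lborel. tail M X t) + tail_integral M X y"
    unfolding tail_integral_def
    using \<open>x \<le> y\<close> by (intro set_integral_Un int) auto
  finally have diff: "tail_integral M X x - tail_integral M X y
      = (LINT t:{x..<y}|lborel. tail M X t)"
    by simp
  have int_const: "set_integrable lborel {x..<y} (\<lambda>_. c)" for c :: real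
    using \<open>x \<le> y\<close> by (auto simp: set_integrable_def)
  have const: "(LINT t:{x..<y}|lborel. c) = (y - x) * c" for c :: real
    using \<open>x \<le> y\<close> by (subst set_integral_const) auto
  have int_xy: "set_integrable lborel {x..<y} (tail M X)"
    by (rule int) auto
  show "(y - x) * tail M X y \<le> tail_integral M X x - tail_integral M X y"
    unfolding diff const[symmetric]
    by (intro set_integral_mono int_const int_xy tail_antimono assms(1)) auto
  show "tail_integral M X x - tail_integral M X y \<le> (y - x) * tail M X x"
    unfolding diff const[symmetric]
    by (intro set_integral_mono int_const int_xy tail_antimono assms(1)) auto
qed

lemma tail_integral_bounds:
  assumes "positive_rv M X" "esup M X < \<infinity>" "x \<le> esup_real M X"
  shows "0 \<le> tail_integral M X x"
    and "tail_integral M X x \<le> (esup_real M X - x) * tail M X x"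
proof -
  have "tail_integral M X (esup_real M X) = (LINT t:{esup_real M X..}|lborel. 0)"
    unfolding tail_integral_def
    by (intro set_lebesgue_integral_cong) (auto simp: tail_eq_0[OF assms(1,2)])
  then have "tail_integral M X (esup_real M X) = 0"
    by (simp add: set_lebesgue_integral_def)
  with tail_integral_diff_bounds[OF assms] tail_eq_0[OF assms(1,2) order_refl]
  show "0 \<le> tail_integral M X x"
    and "tail_integral M X x \<le> (esup_real M X - x) * tail M X x"
    by auto
qed

text \<open>For \<open>x < y\<close> the difference quotient lies between \<open>- w x\<close> and \<open>- w y\<close>, so right-continuity of
  the tail \<open>w\<close> determines its limit.\<close>

lemma tail_integral_right_derivative:
  assumes "positive_rv M X" "esup M X < \<infinity>"
  shows "(tail_integral M X has_real_derivative - tail M X x) (at_right x)"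
  unfolding has_field_derivative_iff
proof (rule tendsto_sandwich[of "\<lambda>_. - tail M X x" _ _ "\<lambda>y. - tail M X y"])
  have gt: "\<forall>\<^sub>F y in at_right x. x < y"
    by (rule eventually_at_right_less)
  show "\<forall>\<^sub>F y in at_right x. - tail M X x
      \<le> (tail_integral M X y - tail_integral M X x) / (y - x)"
    using gt
  proof eventually_elim
    case (elim y)
    with tail_integral_diff_bounds[OF assms, of x y] show ?case
      by (simp add: field_simps)
  qed
  show "\<forall>\<^sub>F y in at_right x. (tail_integral M X y - tail_integral M X x) / (y - x)
      \<le> - tail M X y"
    using gt
  proof eventually_elim
    case (elim y)
    with tail_integral_diff_bounds[OF assms, of x y] show ?case
      by (simp add: field_simps)
  qed
qed (auto intro!: tendsto_minus tail_right_continuous assms)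

section \<open>Derivatives of a twice differentiable tail integral\<close>

lemma deriv_within_eqI:
  assumes "(f has_real_derivative D) (at x within {0..<b})" "x \<in> {0..<b}"
  shows "deriv_within {0..<b} f x = D"
proof -
  have "at x within {0..<b} \<noteq> bot"
    using assms(2) by (auto simp: trivial_limit_within islimpt_Ico)
  then show ?thesis
    using assms(1) unfolding deriv_within_def
    by (intro vector_derivative_within) (simp_all add: has_real_derivative_iff_has_vector_derivative)
qed

text \<open>Conclusions are stated on the open interval, where the derivatives within \<open>[0, b)\<close> are
  two-sided.\<close>

lemma tail_C1_and_beta:
  fixes M X
  defines "b \<equiv> esup_real M X"
  assumes rv: "positive_rv M X" and fin: "esup M X < \<infinity>"
    and C2: "C2_on (tail_integral M X) {0..<b}"
  obtains v where
    "\<And>x. x \<in> {0<..<b} \<Longrightarrow> (tail_integral M X has_real_derivative - tail M X x) (at x)"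
    "\<And>x. x \<in> {0<..<b} \<Longrightarrow> (tail M X has_real_derivative - v x) (at x)"
    "\<And>x. x \<in> {0<..<b} \<Longrightarrow> beta_function M X x = v x * tail_integral M X x / (tail M X x)\<^sup>2"
proof -
  obtain u v where
    u: "\<And>x. x \<in> {0..<b} \<Longrightarrow>
      (tail_integral M X has_real_derivative u x) (at x within {0..<b})" and
    v: "\<And>x. x \<in> {0..<b} \<Longrightarrow> (u has_real_derivative v x) (at x within {0..<b})"
    using C2 unfolding C2_on_def by blast
  \<comment> \<open>Both \<open>u x\<close> and \<open>- tail M X x\<close> are right derivatives of the tail integral at \<open>x\<close>.\<close>
  have u_eq: "u x = - tail M X x" if x: "x \<in> {0..<b}" for x
  proof (rule has_field_derivative_unique)
    show "(tail_integral M X has_real_derivative u x) (at x within {x<..<b})"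
      using x by (intro has_field_derivative_subset[OF u]) auto
    show "(tail_integral M X has_real_derivative - tail M X x) (at x within {x<..<b})"
      using tail_integral_right_derivative[OF rv fin]
      by (rule has_field_derivative_subset) auto
    show "at x within {x<..<b} \<noteq> bot"
      using x by (simp add: trivial_limit_within islimpt_greaterThanLessThan1)
  qed
  have minus_tail: "((\<lambda>x. - tail M X x) has_real_derivative v x) (at x within {0..<b})"
    if "x \<in> {0..<b}" for x
    using v[OF that] zero_less_one that
    by (rule has_field_derivative_transform_within) (simp add: u_eq)
  have deriv1: "deriv_within {0..<b} (tail_integral M X) x = - tail M X x"
    if "x \<in> {0..<b}" for x
    using deriv_within_eqI[OF u[OF that] that] u_eq[OF that] by simp
  have deriv2: "deriv_within {0..<b} (deriv_within {0..<b} (tail_integral M X)) x = v x"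
    if "x \<in> {0..<b}" for x
  proof (rule deriv_within_eqI)
    show "(deriv_within {0..<b} (tail_integral M X) has_real_derivative v x)
        (at x within {0..<b})"
      using v[OF that] zero_less_one that
      by (rule has_field_derivative_transform_within) (simp add: u_eq deriv1)
  qed (rule that)
  have interior: "at x within {0..<b} = at x" if "x \<in> {0<..<b}" for x
    using that by (intro at_within_interior) (simp add: interior_atLeastLessThan)
  show thesis
  proof
    fix x assume x: "x \<in> {0<..<b}"
    show "(tail_integral M X has_real_derivative - tail M X x) (at x)"
      using u[of x] u_eq[of x] x interior[OF x] by auto
    show "(tail M X has_real_derivative - v x) (at x)"
      using DERIV_minus[OF minus_tail[of x]] x interior[OF x] by simp
    show "beta_function M X x = v x * tail_integral M X x / (tail M X x)\<^sup>2"
      using x deriv1[of x] deriv2[of x]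
      by (simp add: beta_function_def Let_def flip: b_def)
  qed
qed

section \<open>Regular variation of the tail\<close>

theorem proposition2p2:
  fixes M :: "'a measure" and X :: "'a \<Rightarrow> real" and \<beta>0 :: real
  assumes "positive_rv M X"
    and "esup M X < \<infinity>"
    and "C2_on (tail_integral M X) {0..<esup_real M X}"
    and "(beta_function M X \<longlongrightarrow> \<beta>0) (at_left (esup_real M X))"
    and "\<beta>0 < 1"
  shows "regularly_varying M X (\<beta>0 / (1 - \<beta>0))"
proof -
  define b where "b = esup_real M X"
  define W where "W z = tail M X (b - z)" for z
  define H where "H z = tail_integral M X (b - z)" for z
  note rv = assms(1,2)
  have "b > 0"
    using esup_eq_ereal(2)[OF rv] by (simp add: b_def)
  obtain v where
    h_deriv: "\<And>x. x \<in> {0<..<b} \<Longrightarrow> (tail_integral M X has_real_derivative - tail M X x) (at x)" and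
    w_deriv: "\<And>x. x \<in> {0<..<b} \<Longrightarrow> (tail M X has_real_derivative - v x) (at x)" and
    beta: "\<And>x. x \<in> {0<..<b} \<Longrightarrow>
      beta_function M X x = v x * tail_integral M X x / (tail M X x)\<^sup>2"
    using tail_C1_and_beta[OF assms(1-3)] unfolding b_def by blast
  have near: "\<forall>\<^sub>F z in at_right 0. 0 < z \<and> z < b"
    using \<open>b > 0\<close> by (auto simp: eventually_at_right_field)
  have reflect: "(g has_real_derivative D) (at (b - z)) \<Longrightarrow>
      ((\<lambda>z. g (b - z)) has_real_derivative - D) (at z)" for g D z
    by (rule DERIV_chain2[where g = "\<lambda>z. b - z", THEN DERIV_cong])
      (auto intro!: derivative_eq_intros)
  have W_pos: "\<forall>\<^sub>F z in at_right 0. W z > 0"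
    using near by eventually_elim (simp add: W_def b_def tail_pos[OF rv])
  have H_bounds: "\<forall>\<^sub>F z in at_right 0. 0 \<le> H z \<and> H z \<le> z * W z"
    using near
  proof eventually_elim
    case (elim z)
    then show ?case
      using tail_integral_bounds[OF rv, of "b - z"] by (simp add: W_def H_def b_def)
  qed
  have H_deriv: "\<forall>\<^sub>F z in at_right 0. (H has_real_derivative W z) (at z)"
    using near
  proof eventually_elim
    case (elim z)
    then show ?case
      using reflect[OF h_deriv[of "b - z"]] by (simp add: H_def[abs_def] W_def)
  qed
  have W_deriv: "\<forall>\<^sub>F z in at_right 0. (W has_real_derivative v (b - z)) (at z)"
    using near
  proof eventually_elim
    case (elim z)
    then show ?case
      using reflect[OF w_deriv[of "b - z"]] by (simp add: W_def[abs_def])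
  qed
  have lim: "((\<lambda>z. v (b - z) * H z / (W z)\<^sup>2) \<longlongrightarrow> \<beta>0) (at_right 0)"
  proof -
    have "filterlim (\<lambda>z. b - z) (at_left b) (at_right 0)"
      using near by (auto simp: filterlim_at intro!: tendsto_eq_intros elim!: eventually_mono)
    then have "((\<lambda>z. beta_function M X (b - z)) \<longlongrightarrow> \<beta>0) (at_right 0)"
      using filterlim_compose assms(4) unfolding b_def by blast
    moreover have "\<forall>\<^sub>F z in at_right 0. beta_function M X (b - z) = v (b - z) * H z / (W z)\<^sup>2"
      using near by eventually_elim (simp add: beta H_def W_def)
    ultimately show ?thesis
      by (simp add: tendsto_cong)
  qed
  have "\<beta>0 \<ge> 0"
  proof (rule tendsto_lowerbound[OF lim])
    have "mono_on UNIV W"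
      by (auto simp: W_def intro!: mono_onI tail_antimono[OF assms(1)])
    then have "\<forall>\<^sub>F z in at_right 0. v (b - z) \<ge> 0"
      using mono_on_imp_deriv_nonneg[of UNIV W] by (intro eventually_mono[OF W_deriv]) simp
    then show "\<forall>\<^sub>F z in at_right 0. 0 \<le> v (b - z) * H z / (W z)\<^sup>2"
      using H_bounds by eventually_elim auto
  qed simp
  have "((\<lambda>z. W (l * z) / (l powr (\<beta>0 / (1 - \<beta>0)) * W z)) \<longlongrightarrow> 1) (at_right 0)"
    if "l > 0" for l
  proof -
    have "((\<lambda>z. W (l * z) / W z) \<longlongrightarrow> l powr (\<beta>0 / (1 - \<beta>0))) (at_right 0)"
      using log_derivative_limit[OF W_pos H_bounds H_deriv W_deriv lim assms(5)]
      by (rule ratio_tendsto_powr[OF W_pos W_deriv _ that])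
    from tendsto_divide[OF this tendsto_const[of "l powr (\<beta>0 / (1 - \<beta>0))"]] that
    show ?thesis
      by (simp add: mult.commute)
  qed
  then show ?thesis
    using assms(1,2,5) \<open>\<beta>0 \<ge> 0\<close> by (simp add: regularly_varying_def W_def b_def)
qed

end
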